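(* Let $r\ge 1$ and $k\ge 2$ be integers, let $\mathbf a=(a_1,\dots,a_r)$ be a sequence of positive integers, and let $D=\operatorname{lcm}(a_1,\dots,a_r)$. Put $$\mathbf C=\Big\{(\ell_1,\dots,\ell_r)\in\mathbb Z^r : 0\le \ell_s\le k\Big(\frac{D}{a_s}-1\Big)\text{ for }1\le s\le r\Big\}.$$ Then for every integer $n\ge 0$, the polynomial part $P_{k,\mathbf a}$ of the restricted $k$-multipartition function satisfies $$P_{k,\mathbf a}(n)=\frac{1}{D\,(rk-1)!}\sum_{(\ell_1,\dots,\ell_r)\in\mathbf C}\left[\prod_{s=1}^r\left(\sum_{\substack{i_s,j_s\ge 0\\ i_s\frac{D}{a_s}+j_s=\ell_s}}(-1)^{i_s}\binom{k}{i_s}\binom{j_s+k-1}{j_s}\right)\right]\cdot\prod_{t=1}^{rk-1}\left(\frac{n-a_1\ell_1-\cdots-a_r\ell_r}{D}+t\right).$$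
   Context: For integers $n\ge 0$, the restricted $k$-multipartition function $p_{k,\mathbf a}(n)$ is the number of $k$-tuples $(x^1,\dots,x^k)$ of vectors $x^j=(x^j_1,\dots,x^j_r)\in\mathbb N^r$ (with $0\in\mathbb N$) such that $\sum_{j=1}^k\sum_{i=1}^r a_i x^j_i=n$; its generating function is $\prod_{i=1}^r(1-z^{a_i})^{-k}$. The polynomial part $P_{k,\mathbf a}(n)$ of $p_{k,\mathbf a}(n)$ is its first Sylvester wave, i.e. the coefficient of $t^{-1}$ in the Laurent expansion at $t=0$ of $$\frac{e^{nt}}{(1-e^{-a_1t})^k\cdots(1-e^{-a_rt})^k}.$$ By convention $\binom{k}{i}=0$ for $i>k$. *)

theory Defs
  imports "HOL-Complex_Analysis.Complex_Analysis"
begin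

text \<open>
  The polynomial part of the restricted \<open>k\<close>-multipartition function of \<open>(a 1, \<dots>, a r)\<close>, i.e. its
  first Sylvester wave. Only the values of \<open>a\<close> on \<open>{1..r}\<close> matter.
\<close>

definition multipartition_poly_part :: "nat \<Rightarrow> nat \<Rightarrow> (nat \<Rightarrow> nat) \<Rightarrow> nat \<Rightarrow> complex" where
  "multipartition_poly_part k r a n =
     fls_nth
       (laurent_expansion
         (\<lambda>t. exp (of_nat n * t) / (\<Prod>i=1..r. (1 - exp (- (of_nat (a i) * t))) ^ k)) 0)
       (-1)"

end

theory Submission
  imports Defs
begin

text \<open>
  All the factors \<open>1 - e\<^sup>-\<^sup>a\<^sup>t\<close> can be brought to the common denominator \<open>1 - e\<^sup>-\<^sup>D\<^sup>t\<close>, because every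
  \<open>a\<^sub>s\<close> divides \<open>D\<close>. With \<open>w = exp (- a\<^sub>s t)\<close> and \<open>m\<^sub>s = D / a\<^sub>s\<close> one has
  \<open>1 / (1 - w) = (1 + w + \<dots> + w ^ (m\<^sub>s - 1)) / (1 - exp (- D t))\<close>. The \<open>k\<close>-th power of the numerator is
  a polynomial in \<open>w\<close> of degree \<open>k * (m\<^sub>s - 1)\<close>, and the coefficients of
  \<open>(1 - w ^ m\<^sub>s) ^ k * (1 - w) ^ (- k)\<close> are exactly the inner sums over \<open>(i, j)\<close>
  (\<open>geometric_power_expansion\<close>). Multiplying over \<open>s\<close> and distributing the product over the sums
  turns the function whose residue is wanted into a finite linear combination, indexed by \<open>C\<close>, of
  functions \<open>exp (x t) / (1 - exp (- D t)) ^ (r * k)\<close> with \<open>x = n - (\<Sum>s. a\<^sub>s * l\<^sub>s)\<close>.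

  It remains to know the residue of one such function at \<open>0\<close>
  (\<open>residue_exp_over_one_minus_exp_power\<close>). As the derivative of a Laurent series has no term of
  degree \<open>-1\<close>, differentiating \<open>exp (x t) / (1 - exp (- D t)) ^ N\<close> gives a relation between the
  residues for the exponents \<open>N\<close> and \<open>N + 1\<close>, which unwinds to the product \<open>\<Prod>t. x / D + t\<close>.
\<close>

text \<open>
  The coefficient of \<open>w ^ l\<close> in \<open>(1 + w + \<dots> + w ^ (m - 1)) ^ k\<close>, written as the Cauchy product of
  the expansions of \<open>(1 - w ^ m) ^ k\<close> and \<open>(1 - w) ^ (- k)\<close>.
\<close>

definition geom_power_coeff :: "nat \<Rightarrow> nat \<Rightarrow> int \<Rightarrow> 'a :: comm_ring_1" where
  "geom_power_coeff k m l =
     (\<Sum>(i, j) \<in> {(i :: nat, j :: nat). int (i * m + j) = l}.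
        (-1) ^ i * of_nat (k choose i) * of_nat ((j + k - 1) choose j))"

text \<open>
  Only one \<open>j\<close> goes with each \<open>i\<close>, and the terms with \<open>i > k\<close> vanish. For \<open>m = 0\<close> every \<open>i\<close> would be
  admissible and the index set of the defining sum would be infinite.
\<close>

lemma geom_power_coeff_of_nat:
  assumes "m > 0"
  shows "(geom_power_coeff k m (int l) :: 'a :: comm_ring_1) =
           (\<Sum>i\<le>k. if i * m \<le> l then (-1) ^ i * of_nat (k choose i) *
              of_nat ((l - i * m + k - 1) choose (l - i * m)) else 0)"
proof -
  let ?t = "\<lambda>i j. (-1) ^ i * of_nat (k choose i) * of_nat ((j + k - 1) choose j) :: 'a"
  have pairs: "{(i, j). int (i * m + j) = int l} = (\<lambda>i. (i, l - i * m)) ` {i. i * m \<le> l}"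
    by (auto simp: image_iff simp flip: of_nat_add of_nat_mult)
  have "i \<le> l" if "i * m \<le> l" for i
    using that assms by (metis le_trans mult.right_neutral mult_le_mono2 Suc_leI One_nat_def)
  hence fin: "finite {i. i * m \<le> l}"
    by (auto intro: finite_subset[of _ "{..l}"])
  have "geom_power_coeff k m (int l) = (\<Sum>i | i * m \<le> l. ?t i (l - i * m))"
    unfolding geom_power_coeff_def pairs by (subst sum.reindex) (auto simp: inj_on_def)
  also have "\<dots> = (\<Sum>i | i \<le> k \<and> i * m \<le> l. ?t i (l - i * m))"
    using fin by (intro sum.mono_neutral_right) (auto simp: not_le binomial_eq_0 intro: ccontr)
  also have "\<dots> = (\<Sum>i\<le>k. if i * m \<le> l then ?t i (l - i * m) else 0)"
    by (simp add: sum.If_cases Collect_conj_eq atMost_def)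
  finally show ?thesis .
qed

text \<open>
  As formal power series, \<open>(\<Sum>i<m. X ^ i) ^ k = (1 - X ^ m) ^ k * (1 - X) ^ (- k)\<close>; the first
  factor is expanded by the binomial theorem and the second by the negative binomial series.
\<close>

lemma coeff_geometric_power:
  fixes m k l :: nat
  assumes "m > 0" "k > 0"
  shows "coeff ((\<Sum>i<m. monom 1 i) ^ k) l = (geom_power_coeff k m (int l) :: 'a :: field_char_0)"
proof -
  define S :: "'a fps" where "S = fps_of_poly (\<Sum>i<m. monom 1 i)"
  define A :: "'a fps" where "A = Abs_fps (\<lambda>j. of_nat ((k + j - 1) choose j))"
  have S: "S = (\<Sum>i<m. fps_X ^ i)"
    unfolding S_def by (simp add: fps_of_poly_sum fps_of_poly_monom)
  have A: "A = inverse ((1 - fps_X) ^ k)"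
    using one_minus_const_fps_X_neg_power'[OF assms(2), of "1 :: 'a"] by (simp add: A_def)
  have "1 - fps_X ^ m = (1 - fps_X) * S"
    unfolding S by (rule one_diff_power_eq)
  hence "(1 - fps_X ^ m) ^ k * A = S ^ k * ((1 - fps_X) ^ k * inverse ((1 - fps_X) ^ k))"
    by (simp add: A power_mult_distrib mult_ac)
  also have "(1 - fps_X) ^ k * inverse ((1 - fps_X) ^ k) = (1 :: 'a fps)"
    by (rule inverse_mult_eq_1') simp
  finally have SA: "S ^ k = (1 - fps_X ^ m) ^ k * A" by simp
  have "(1 - fps_X ^ m :: 'a fps) ^ k = (- (fps_X ^ m) + 1) ^ k"
    by simp
  also have "\<dots> = (\<Sum>i\<le>k. of_nat (k choose i) * (- (fps_X ^ m)) ^ i)"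
    by (subst binomial_ring) simp
  also have "\<dots> = (\<Sum>i\<le>k. fps_const ((-1) ^ i * of_nat (k choose i)) * fps_X ^ (i * m))"
    by (intro sum.cong refl, subst power_minus)
       (simp add: fps_of_nat mult_ac flip: power_mult fps_const_power fps_const_mult fps_const_neg)
  finally have "(S ^ k) $ l =
      (\<Sum>i\<le>k. (fps_const ((-1) ^ i * of_nat (k choose i)) * (fps_X ^ (i * m) * A)) $ l)"
    by (simp add: SA sum_distrib_right fps_sum_nth mult.assoc)
  also have "\<dots> = geom_power_coeff k m (int l)"
    unfolding geom_power_coeff_of_nat[OF assms(1)]
    by (intro sum.cong refl) (simp add: fps_X_power_mult_nth A_def add.commute not_less)
  also have "S ^ k = fps_of_poly ((\<Sum>i<m. monom 1 i) ^ k)"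
    by (simp add: S_def fps_of_poly_power)
  finally show ?thesis by simp
qed

lemma geometric_power_expansion:
  fixes w :: "'a :: field_char_0"
  assumes "m > 0" "k > 0"
  shows "(\<Sum>i<m. w ^ i) ^ k =
           (\<Sum>l\<in>{0..int k * (int m - 1)}. geom_power_coeff k m l * w ^ nat l)"
proof -
  define p :: "'a poly" where "p = (\<Sum>i<m. monom 1 i)"
  have "degree p \<le> m - 1"
    unfolding p_def by (intro degree_sum_le) (auto intro: order.trans[OF degree_monom_le])
  hence deg: "degree (p ^ k) \<le> k * (m - 1)"
    by (metis degree_power_le le_trans mult.commute mult_le_mono2)
  have "(\<Sum>i<m. w ^ i) ^ k = poly (p ^ k) w"
    by (simp add: p_def poly_sum poly_monom)
  also have "\<dots> = (\<Sum>l\<le>k * (m - 1). coeff (p ^ k) l * w ^ l)"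
    unfolding poly_altdef using deg
    by (intro sum.mono_neutral_left) (auto simp: coeff_eq_0)
  also have "\<dots> = (\<Sum>l\<le>k * (m - 1). geom_power_coeff k m (int l) * w ^ nat (int l))"
    by (simp add: p_def coeff_geometric_power[OF assms])
  also have "\<dots> = (\<Sum>l\<in>int ` {..k * (m - 1)}. geom_power_coeff k m l * w ^ nat l)"
    by (subst sum.reindex) auto
  also have "int ` {..k * (m - 1)} = {0..int k * (int m - 1)}"
    using assms by (simp add: atMost_atLeast0 image_int_atLeastAtMost of_nat_diff)
  finally show ?thesis .
qed

text \<open>
  Let \<open>R N x\<close> be the residue of \<open>e\<^sup>x\<^sup>t / (1 - e\<^sup>-\<^sup>d\<^sup>t) ^ N\<close>. The derivative of that series is
  \<open>x * e\<^sup>x\<^sup>t / (1 - e\<^sup>-\<^sup>d\<^sup>t) ^ N - N * d * exp ((x - d) t) / (1 - e\<^sup>-\<^sup>d\<^sup>t) ^ (N + 1)\<close> and has residue \<open>0\<close>.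
  Hence \<open>R (N + 1) (x - d) = x / (N * d) * R N x\<close>. The shift of \<open>x\<close> by \<open>d\<close> shifts all factors
  \<open>x / d + t\<close> of the product by one, so the induction has to keep \<open>x\<close> arbitrary. It starts at the
  simple pole \<open>N = 1\<close>, where the residue is \<open>1 / d\<close>.
\<close>

lemma residue_exp_over_one_minus_exp_power:
  fixes d x :: "'a :: field_char_0"
  assumes "d \<noteq> 0"
  shows "fls_residue (fps_to_fls (fps_exp x) * inverse (1 - fps_to_fls (fps_exp (-d))) ^ Suc N) =
           1 / (d * fact N) * (\<Prod>t=1..N. x / d + of_nat t)"
proof (induction N arbitrary: x)
  case 0
  define g where "g = fps_shift 1 (1 - fps_exp (-d))"
  have g0: "g $ 0 = d" by (simp add: g_def)
  have "1 - fps_exp (-d) = g * fps_X"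
    unfolding g_def by (rule fps_ext) (simp add: fps_mult_fps_X_commute)
  hence "1 - fps_to_fls (fps_exp (-d)) = fps_to_fls (g * fps_X)"
    by (metis fps_to_fls_minus fps_one_to_fls)
  also have "\<dots> = fps_to_fls g * fls_X"
    by (simp add: fls_times_fps_to_fls)
  finally have "inverse (1 - fps_to_fls (fps_exp (-d))) = fps_to_fls (inverse g) * fls_X_inv"
    using g0 assms by (simp add: fls_inverse_X fls_inverse_fps_to_fls subdegree_eq_0)
  hence "fps_to_fls (fps_exp x) * inverse (1 - fps_to_fls (fps_exp (-d))) =
           fps_to_fls (fps_exp x * inverse g) * fls_X_inv"
    by (simp add: fls_times_fps_to_fls mult.assoc)
  thus ?case
    using g0 by (simp add: fls_X_inv_times_conv_shift fps_inverse_def field_simps)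
next
  case (Suc N)
  define E where "E = (\<lambda>x :: 'a. fps_to_fls (fps_exp x))"
  define G where "G = 1 - E (-d)"
  have E_deriv: "fls_deriv (E y) = fls_const y * E y" for y
    by (simp add: E_def fls_deriv_fps_to_fls fls_times_fps_to_fls)
  have E_add: "E (y + z) = E y * E z" for y z
    by (simp add: E_def fps_exp_add_mult fls_times_fps_to_fls)
  have G_deriv: "fls_deriv G = fls_const d * E (-d)"
    by (simp add: G_def E_deriv)
  \<comment> \<open>The induction hypothesis is used at \<open>x + d\<close>, since differentiating \<open>1 / G ^ Suc N\<close> brings in
    the factor \<open>E (-d)\<close>.\<close>
  define y where "y = x + d"
  define I where "I = inverse G"
  have I_deriv: "fls_deriv (I ^ Suc N) = - (of_nat (Suc N) * fls_const d * E (-d) * I ^ Suc (Suc N))"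
    unfolding fls_deriv_power unfolding I_def
    by (simp add: fls_inverse_deriv G_deriv power2_eq_square mult_ac)
  have "fls_deriv (E y * I ^ Suc N) =
          fls_const y * (E y * I ^ Suc N) - fls_const (of_nat (Suc N) * d) * (E x * I ^ Suc (Suc N))"
    unfolding fls_deriv_mult I_deriv E_deriv using E_add[of y "-d"]
    by (simp add: y_def fls_of_nat mult_ac flip: fls_const_mult_const)
  from arg_cong[OF this, of fls_residue]
  have "y * fls_residue (E y * I ^ Suc N) = of_nat (Suc N) * d * fls_residue (E x * I ^ Suc (Suc N))"
    by (simp add: fls_deriv_residue del: fls_deriv_mult fls_deriv_nth power_Suc of_nat_Suc)
  hence "fls_residue (E x * I ^ Suc (Suc N)) = y / (of_nat (Suc N) * d) * fls_residue (E y * I ^ Suc N)"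
    using assms by (simp add: field_simps del: of_nat_Suc)
  also have "\<dots> = y / (of_nat (Suc N) * d) * (1 / (d * fact N) * (\<Prod>t=1..N. y / d + of_nat t))"
    unfolding E_def I_def G_def Suc.IH ..
  also have "\<dots> = 1 / (d * fact (Suc N)) * ((x / d + 1) * (\<Prod>t=1..N. x / d + of_nat (Suc t)))"
    using assms by (simp add: y_def field_simps)
  also have "(x / d + 1) * (\<Prod>t=1..N. x / d + of_nat (Suc t)) = (\<Prod>t=1..Suc N. x / d + of_nat t)"
    by (subst prod.atLeast_Suc_atMost) (simp_all add: prod.shift_bounds_cl_Suc_ivl del: of_nat_Suc prod.cl_ivl_Suc)
  finally show ?case by (simp add: E_def I_def G_def)
qed

theorem theorem4p2:
  fixes r k n D :: nat and a :: "nat \<Rightarrow> nat" and C :: "(nat \<Rightarrow> int) set"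
  assumes "r \<ge> 1" and "k \<ge> 2"
    and "\<And>i. i \<in> {1..r} \<Longrightarrow> a i > 0"
    and "D = (LCM i\<in>{1..r}. a i)"
    and "C = (\<Pi>\<^sub>E s\<in>{1..r}. {0..int k * (int (D div a s) - 1)})"
  shows "multipartition_poly_part k r a n =
    1 / (of_nat D * fact (r * k - 1)) *
    (\<Sum>l\<in>C.
       (\<Prod>s=1..r. \<Sum>(i, j) \<in> {(i :: nat, j :: nat). int (i * (D div a s) + j) = l s}.
          (-1) ^ i * of_nat (k choose i) * of_nat ((j + k - 1) choose j)) *
       (\<Prod>t=1..r * k - 1.
          of_int (int n - (\<Sum>s=1..r. int (a s) * l s)) / of_nat D + of_nat t))"
proof -
  define m where "m = (\<lambda>s. D div a s)"
  define c :: "(nat \<Rightarrow> int) \<Rightarrow> complex"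
    where "c = (\<lambda>l. \<Prod>s=1..r. geom_power_coeff k (m s) (l s))"
  define e where "e = (\<lambda>l. int n - (\<Sum>s=1..r. int (a s) * l s))"
  define N where "N = r * k - 1"
  have N: "r * k = Suc N"
    using assms(1,2) unfolding N_def by (cases r; cases k) auto
  have D: "D > 0"
    using assms(3) unfolding assms(4) by (intro Nat.gr0I) (force simp: Lcm_0_iff)
  have Dm: "D = a s * m s" if "s \<in> {1..r}" for s
    unfolding m_def using that by (simp add: assms(4))
  have m: "m s > 0" if "s \<in> {1..r}" for s
    using D Dm[OF that] by (intro Nat.gr0I) auto

  \<comment> \<open>The rearrangement of \<open>f\<close> over the common denominator \<open>g\<close> holds wherever \<open>g\<close> does not vanish; near \<open>0\<close> this excludes only
    \<open>0\<close> itself, so that it determines the Laurent expansion.\<close>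
  define g :: "complex \<Rightarrow> complex" where "g = (\<lambda>t. 1 - exp (- of_nat D * t))"
  define G where "G = 1 - fps_to_fls (fps_exp (- of_nat D :: complex))"
  have exp_expansion: "(\<lambda>t. exp (x * t)) has_laurent_expansion fps_to_fls (fps_exp x)" for x :: complex
    by (intro has_laurent_expansion_fps fps_expansion_intros)
  have g: "g has_laurent_expansion G"
    unfolding g_def G_def by (intro laurent_expansion_intros exp_expansion)
  have "fls_nth G 1 = of_nat D"
    by (simp add: G_def)
  hence "G \<noteq> 0" using D by auto
  hence nz: "\<forall>\<^sub>F t in at 0. g t \<noteq> 0"
    using has_laurent_expansion_eventually_nonzero_iff[of g 0 G] g by simp

  define f where "f = (\<lambda>t :: complex.
    exp (of_nat n * t) / (\<Prod>i=1..r. (1 - exp (- (of_nat (a i) * t))) ^ k))"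
  have f_eq: "f t = (\<Sum>l\<in>C. c l * (exp (of_int (e l) * t) * inverse (g t) ^ Suc N))" if "g t \<noteq> 0" for t
  proof -
    define w where "w = (\<lambda>s. exp (- (of_nat (a s) * t)))"
    have w_pow: "w s ^ m s = 1 - g t" if "s \<in> {1..r}" for s
      using Dm[OF that] by (simp add: w_def g_def mult_ac flip: exp_of_nat_mult)
    have factor: "inverse ((1 - w s) ^ k) = inverse (g t) ^ k *
        (\<Sum>l\<in>{0..int k * (int (m s) - 1)}. geom_power_coeff k (m s) l * w s ^ nat l)"
      if s: "s \<in> {1..r}" for s
    proof -
      have "g t = (1 - w s) * (\<Sum>i<m s. w s ^ i)"
        using w_pow[OF s] one_diff_power_eq[of "w s" "m s"] by simp
      hence "inverse (1 - w s) = inverse (g t) * (\<Sum>i<m s. w s ^ i)"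
        using \<open>g t \<noteq> 0\<close> by simp
      hence "inverse ((1 - w s) ^ k) = inverse (g t) ^ k * (\<Sum>i<m s. w s ^ i) ^ k"
        by (simp only: power_mult_distrib flip: power_inverse)
      thus ?thesis
        using geometric_power_expansion[of "m s" k "w s"] m[OF s] assms(2) by simp
    qed
    have "f t = exp (of_nat n * t) * (\<Prod>s=1..r. inverse ((1 - w s) ^ k))"
      by (simp add: f_def w_def divide_inverse prod_inversef[symmetric, unfolded comp_def])
    also have "\<dots> = exp (of_nat n * t) * ((\<Prod>s=1..r. inverse (g t) ^ k) *
        (\<Prod>s=1..r. \<Sum>l\<in>{0..int k * (int (m s) - 1)}. geom_power_coeff k (m s) l * w s ^ nat l))"
      by (simp add: factor prod.distrib)
    also have "(\<Prod>s=1..r. inverse (g t) ^ k) = inverse (g t) ^ Suc N"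
      by (simp add: mult.commute flip: power_mult N)
    also have "(\<Prod>s=1..r. \<Sum>l\<in>{0..int k * (int (m s) - 1)}. geom_power_coeff k (m s) l * w s ^ nat l) =
        (\<Sum>l\<in>C. \<Prod>s=1..r. geom_power_coeff k (m s) (l s) * w s ^ nat (l s))"
      unfolding assms(5) m_def by (subst prod_sum_PiE) auto
    also have "\<dots> = (\<Sum>l\<in>C. c l * (\<Prod>s=1..r. w s ^ nat (l s)))"
      by (simp add: c_def prod.distrib)
    also have "exp (of_nat n * t) * (inverse (g t) ^ Suc N * \<dots>) =
        (\<Sum>l\<in>C. c l * (exp (of_nat n * t) * (\<Prod>s=1..r. w s ^ nat (l s)) * inverse (g t) ^ Suc N))"
      by (simp add: sum_distrib_left mult_ac)
    also have "\<dots> = (\<Sum>l\<in>C. c l * (exp (of_int (e l) * t) * inverse (g t) ^ Suc N))"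
    proof (intro sum.cong refl)
      fix l assume l: "l \<in> C"
      have "w s ^ nat (l s) = exp (- (of_int (int (a s) * l s) * t))" if "s \<in> {1..r}" for s
      proof -
        have "l s \<ge> 0" using l that by (auto simp: assms(5) PiE_iff)
        thus ?thesis
          by (simp add: w_def mult_ac flip: exp_of_nat_mult)
      qed
      hence "exp (of_nat n * t) * (\<Prod>s=1..r. w s ^ nat (l s)) = exp (of_int (e l) * t)"
        by (simp add: e_def sum_negf sum_distrib_right left_diff_distrib flip: exp_sum exp_add)
      thus "c l * (exp (of_nat n * t) * (\<Prod>s=1..r. w s ^ nat (l s)) * inverse (g t) ^ Suc N) =
            c l * (exp (of_int (e l) * t) * inverse (g t) ^ Suc N)" by simp
    qed
    finally show ?thesis .
  qed

  define F where "F = (\<Sum>l\<in>C. fls_const (c l) * (fps_to_fls (fps_exp (of_int (e l))) * inverse G ^ Suc N))"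
  have "(\<lambda>t. \<Sum>l\<in>C. c l * (exp (of_int (e l) * t) * inverse (g t) ^ Suc N)) has_laurent_expansion F"
    unfolding F_def by (intro laurent_expansion_intros exp_expansion g)
  also have "?this \<longleftrightarrow> f has_laurent_expansion F"
    using nz by (intro has_laurent_expansion_cong refl) (auto elim!: eventually_mono simp: f_eq)
  finally have "laurent_expansion f 0 = F"
    by (intro laurent_expansion_eqI) simp
  hence "multipartition_poly_part k r a n = fls_residue F"
    by (simp add: multipartition_poly_part_def f_def)
  also have "\<dots> = (\<Sum>l\<in>C. c l *
      fls_residue (fps_to_fls (fps_exp (of_int (e l))) * inverse G ^ Suc N))"
    unfolding F_def fls_residue_def fls_nth_sum
    by (simp add: fls_residue_fls_const_times(1)[unfolded fls_residue_def])
  also have "\<dots> = (\<Sum>l\<in>C. c l *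
      (1 / (of_nat D * fact N) * (\<Prod>t=1..N. of_int (e l) / of_nat D + of_nat t)))"
    unfolding G_def using D by (subst residue_exp_over_one_minus_exp_power) auto
  also have "\<dots> = 1 / (of_nat D * fact N) *
      (\<Sum>l\<in>C. c l * (\<Prod>t=1..N. of_int (e l) / of_nat D + of_nat t))"
    by (simp add: sum_distrib_left mult_ac)
  finally show ?thesis
    by (simp only: c_def e_def m_def N_def geom_power_coeff_def)
qed

end
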